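(* Let the angular power spectrum $(A_\ell,\ell\in\mathbb N_0)$ of the centered, isotropic Gaussian random field $T$ on $\mathbb S^2$ decay algebraically with order $\alpha>2$; that is, there exist constants $C>0$ and $\ell_0\in\mathbb N$ such that $A_\ell\le C\,\ell^{-\alpha}$ for all $\ell>\ell_0$. Then the sequence of approximate (truncated) random fields $(T^\kappa,\kappa\in\mathbb N)$ converges to $T$ in $L^2(\Omega;L^2(\mathbb S^2))$, and the truncation error is bounded by $$\|T-T^\kappa\|_{L^2(\Omega;L^2(\mathbb S^2))}\le\hat C\,\kappa^{-(\alpha-2)/2}$$ for $\kappa\ge\ell_0$, where $$\hat C^2=C\Bigl(\frac{2}{\alpha-2}+\frac1{\alpha-1}\Bigr).$$
   Context: $\mathbb S^2$ is the unit sphere in $\mathbb R^3$ with surface measure. A centered isotropic Gaussian random field on $\mathbb S^2$ is a jointly measurable Gaussian map $T:\Omega\times\mathbb S^2\to\mathbb R$ with mean zero and covariance invariant under rotations in $\mathrm{SO}(3)$; its angular power spectrum is the sequence of nonnegative reals $(A_\ell)$ with $\mathbb E(T(x)T(y))=\sum_\ell A_\ell\frac{2\ell+1}{4\pi}P_\ell(\langle x,y\rangle)$, $P_\ell$ the Legendre polynomials. Let $P_{\ell m}(\mu)=(-1)^m(1-\mu^2)^{m/2}\frac{\partial^m}{\partial\mu^m}P_\ell(\mu)$ and $L_{\ell m}(\vartheta)=\sqrt{\frac{2\ell+1}{4\pi}\frac{(\ell-m)!}{(\ell+m)!}}P_{\ell m}(\cos\vartheta)$. The field is given by its Karhunen–Loève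 series $$T(y)=\sum_{\ell=0}^\infty\Bigl(\sqrt{A_\ell}X^1_{\ell0}L_{\ell0}(\vartheta)+\sqrt{2A_\ell}\sum_{m=1}^\ell L_{\ell m}(\vartheta)\bigl(X^1_{\ell m}\cos(m\varphi)+X^2_{\ell m}\sin(m\varphi)\bigr)\Bigr),$$ $y=(\sin\vartheta\cos\varphi,\sin\vartheta\sin\varphi,\cos\vartheta)$, with independent real standard normal random variables $X^1_{\ell m}$ ($0\le m\le\ell$), $X^2_{\ell m}$ ($1\le m\le\ell$). For $\kappa\in\mathbb N$, $T^\kappa$ denotes the same expression with the sum over $\ell$ restricted to $0\le\ell\le\kappa$. *)

theory Defs
  imports "HOL-Probability.Probability" "HOL-Computational_Algebra.Polynomial"
begin

section \<open>The unit sphere and its surface measure\<close>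

abbreviation S2 :: "(real ^ 3) set" where
  "S2 \<equiv> sphere 0 1"

definition sph_point :: "real \<Rightarrow> real \<Rightarrow> real ^ 3" where
  "sph_point \<theta> \<phi> = vector [sin \<theta> * cos \<phi>, sin \<theta> * sin \<phi>, cos \<theta>]"

text \<open>Spherical coordinates \<open>\<theta> \<in> [0, \<pi>]\<close> and \<open>\<phi> \<in> [0, 2\<pi>)\<close> of a point of the sphere.
  At the two poles, where \<open>\<phi>\<close> is not determined, the longitude is 0. This choice is immaterial
  for the expansion below, since the functions \<open>L_fun l m\<close> with \<open>m \<ge> 1\<close> vanish there.\<close>

definition colatitude :: "real ^ 3 \<Rightarrow> real" where
  "colatitude y = arccos (y $ 3)"

definition longitude :: "real ^ 3 \<Rightarrow> real" where
  "longitude y = Arg2pi (Complex (y $ 1) (y $ 2))"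

lemma sph_point_in_S2: "sph_point \<theta> \<phi> \<in> S2"
proof -
  have "(norm (sph_point \<theta> \<phi>))\<^sup>2
      = (sin \<theta> * cos \<phi>)\<^sup>2 + (sin \<theta> * sin \<phi>)\<^sup>2 + (cos \<theta>)\<^sup>2"
    unfolding power2_norm_eq_inner inner_vec_def
    by (simp add: sum_3 sph_point_def power2_eq_square)
  also have "\<dots> = (sin \<theta>)\<^sup>2 * ((cos \<phi>)\<^sup>2 + (sin \<phi>)\<^sup>2) + (cos \<theta>)\<^sup>2"
    by (simp only: power_mult_distrib distrib_left)
  finally have "(norm (sph_point \<theta> \<phi>))\<^sup>2 = 1"
    by simp
  then show ?thesis
    using norm_ge_zero[of "sph_point \<theta> \<phi>"] by (simp add: power2_eq_1_iff)
qed

lemma sph_point_coordinates: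
  assumes "y \<in> S2"
  shows "sph_point (colatitude y) (longitude y) = y"
proof -
  let ?z = "Complex (y $ 1) (y $ 2)"
  have "(norm y)\<^sup>2 = 1"
    using assms by simp
  then have n: "(y $ 1)\<^sup>2 + (y $ 2)\<^sup>2 + (y $ 3)\<^sup>2 = 1"
    unfolding power2_norm_eq_inner inner_vec_def
    by (simp add: sum_3 power2_eq_square)
  then have "(y $ 3)\<^sup>2 \<le> 1"
    by (smt (verit) zero_le_power2)
  then have b: "\<bar>y $ 3\<bar> \<le> 1"
    by (simp add: abs_square_le_1)
  then have c: "cos (colatitude y) = y $ 3"
    by (simp add: colatitude_def cos_arccos_abs)
  have "sin (colatitude y) = sqrt (1 - (y $ 3)\<^sup>2)"
    using b by (simp add: colatitude_def sin_arccos_abs)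
  also have "\<dots> = cmod ?z"
    using n by (simp add: cmod_def)
  finally have s: "sin (colatitude y) = cmod ?z" .
  show ?thesis
    using c s cos_Arg2pi[of ?z] sin_Arg2pi[of ?z]
    by (simp add: sph_point_def vec_eq_iff forall_3 longitude_def)
qed

text \<open>The surface measure \<open>d\<sigma>(y) = sin \<theta> d\<theta> d\<phi>\<close>, on the Borel sets of the sphere.\<close>

definition S2_measure :: "(real ^ 3) measure" where
  "S2_measure = distr
     (density lborel
        (\<lambda>(\<theta>, \<phi>). ennreal (indicator ({0..pi} \<times> {0..<2 * pi}) (\<theta>, \<phi>) * sin \<theta>)))
     (restrict_space borel S2) (\<lambda>(\<theta>, \<phi>). sph_point \<theta> \<phi>)"

lemma sets_S2_measure [simp, measurable_cong]: "sets S2_measure = sets (restrict_space borel S2)"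
  by (simp add: S2_measure_def)

lemma space_S2_measure [simp]: "space S2_measure = S2"
  by (simp add: S2_measure_def space_restrict_space)

section \<open>Legendre polynomials and associated Legendre functions\<close>

text \<open>Rodrigues' formula \<open>P\<^sub>l(\<mu>) = (2\<^sup>l l!)\<^sup>-\<^sup>1 (d/d\<mu>)\<^sup>l (\<mu>\<^sup>2 - 1)\<^sup>l\<close>.\<close>

definition legendre_poly :: "nat \<Rightarrow> real poly" where
  "legendre_poly l = smult (1 / (2 ^ l * fact l)) ((pderiv ^^ l) ([:-1, 0, 1:] ^ l))"

text \<open>The factor \<open>(1 - \<mu>\<^sup>2)\<^bsup>m/2\<^esup>\<close> is written as a natural power of a square root, because
  \<open>0 powr 0 = 0\<close> would give a wrong value for \<open>m = 0\<close> and \<open>\<mu> = \<plusminus>1\<close>.\<close>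

definition assoc_legendre :: "nat \<Rightarrow> nat \<Rightarrow> real \<Rightarrow> real" where
  "assoc_legendre l m \<mu> =
     (-1) ^ m * sqrt (1 - \<mu>\<^sup>2) ^ m * poly ((pderiv ^^ m) (legendre_poly l)) \<mu>"

definition L_fun :: "nat \<Rightarrow> nat \<Rightarrow> real \<Rightarrow> real" where
  "L_fun l m \<theta> = sqrt ((2 * real l + 1) / (4 * pi) * (fact (l - m) / fact (l + m)))
     * assoc_legendre l m (cos \<theta>)"

section \<open>Isotropic Gaussian random fields\<close>

text \<open>Possibly degenerate real normal distributions: point masses are included.\<close>

definition gaussian_rv :: "'w measure \<Rightarrow> ('w \<Rightarrow> real) \<Rightarrow> bool" where
  "gaussian_rv M Z \<longleftrightarrow> Z \<in> borel_measurable M \<and>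
     (\<exists>\<mu> \<sigma>. \<sigma> > 0 \<and> distributed M lborel Z (normal_density \<mu> \<sigma>) \<or> (AE \<omega> in M. Z \<omega> = \<mu>))"

text \<open>A random field is a function of the outcome and of a point of \<open>real ^ 3\<close>; only its values
  at points of the sphere are relevant. Joint normality of the finite-dimensional distributions
  means normality of all linear combinations.\<close>

definition gaussian_random_field :: "'w measure \<Rightarrow> ('w \<Rightarrow> real ^ 3 \<Rightarrow> real) \<Rightarrow> bool" where
  "gaussian_random_field M T \<longleftrightarrow>
     case_prod T \<in> borel_measurable (M \<Otimes>\<^sub>M restrict_space borel S2) \<and>
     (\<forall>(k::nat) x a. (\<forall>i<k. x i \<in> S2) \<longrightarrow> gaussian_rv M (\<lambda>\<omega>. \<Sum>i<k. a i * T \<omega> (x i)))"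

definition centered_isotropic_gaussian_field ::
    "'w measure \<Rightarrow> ('w \<Rightarrow> real ^ 3 \<Rightarrow> real) \<Rightarrow> bool" where
  "centered_isotropic_gaussian_field M T \<longleftrightarrow>
     gaussian_random_field M T \<and>
     (\<forall>x\<in>S2. (\<integral>\<omega>. T \<omega> x \<partial>M) = 0) \<and>
     (\<forall>g. rotation_matrix g \<longrightarrow> (\<forall>x\<in>S2. \<forall>y\<in>S2.
        (\<integral>\<omega>. T \<omega> (g *v x) * T \<omega> (g *v y) \<partial>M) = (\<integral>\<omega>. T \<omega> x * T \<omega> y \<partial>M)))"

definition angular_power_spectrum ::
    "'w measure \<Rightarrow> ('w \<Rightarrow> real ^ 3 \<Rightarrow> real) \<Rightarrow> (nat \<Rightarrow> real) \<Rightarrow> bool" where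
  "angular_power_spectrum M T A \<longleftrightarrow>
     (\<forall>l. A l \<ge> 0) \<and>
     (\<forall>x\<in>S2. \<forall>y\<in>S2.
        (\<lambda>l. A l * ((2 * real l + 1) / (4 * pi)) * poly (legendre_poly l) (x \<bullet> y))
        sums (\<integral>\<omega>. T \<omega> x * T \<omega> y \<partial>M))"

section \<open>The Karhunen-Loeve expansion\<close>

text \<open>The coefficient \<open>X i l m\<close>, \<open>i \<in> {1, 2}\<close>, is \<open>X\<^sup>i\<close> with lower indices \<open>l\<close>, \<open>m\<close>.\<close>

definition KL_index :: "(nat \<times> nat \<times> nat) set" where
  "KL_index = {(1, l, m) |l m. m \<le> l} \<union> {(2, l, m) |l m. 1 \<le> m \<and> m \<le> l}"

definition iid_standard_normal ::
    "'w measure \<Rightarrow> (nat \<Rightarrow> nat \<Rightarrow> nat \<Rightarrow> 'w \<Rightarrow> real) \<Rightarrow> bool" where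
  "iid_standard_normal M X \<longleftrightarrow>
     prob_space.indep_vars M (\<lambda>_. borel) (\<lambda>(i, l, m). X i l m) KL_index \<and>
     (\<forall>(i, l, m)\<in>KL_index. distributed M lborel (X i l m) std_normal_density)"

definition KL_trunc ::
    "(nat \<Rightarrow> real) \<Rightarrow> (nat \<Rightarrow> nat \<Rightarrow> nat \<Rightarrow> 'w \<Rightarrow> real) \<Rightarrow> nat \<Rightarrow> 'w \<Rightarrow> real ^ 3 \<Rightarrow> real" where
  "KL_trunc A X \<kappa> \<omega> y = (let \<theta> = colatitude y; \<phi> = longitude y in
     \<Sum>l=0..\<kappa>. sqrt (A l) * X 1 l 0 \<omega> * L_fun l 0 \<theta>
       + sqrt (2 * A l) * (\<Sum>m=1..l. L_fun l m \<theta> *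
           (X 1 l m \<omega> * cos (real m * \<phi>) + X 2 l m \<omega> * sin (real m * \<phi>))))"

text \<open>The series represents \<open>T y\<close> for each point \<open>y\<close>. Convergence is required in probability
  only, which is implied both by almost sure convergence and by convergence in \<open>L\<^sup>2(\<Omega>)\<close>.\<close>

definition KL_expansion ::
    "'w measure \<Rightarrow> ('w \<Rightarrow> real ^ 3 \<Rightarrow> real) \<Rightarrow> (nat \<Rightarrow> real) \<Rightarrow>
     (nat \<Rightarrow> nat \<Rightarrow> nat \<Rightarrow> 'w \<Rightarrow> real) \<Rightarrow> bool" where
  "KL_expansion M T A X \<longleftrightarrow>
     (\<forall>y\<in>S2. \<forall>\<epsilon>>0.
        (\<lambda>\<kappa>. measure M {\<omega> \<in> space M. \<bar>T \<omega> y - KL_trunc A X \<kappa> \<omega> y\<bar> > \<epsilon>}) \<longlonglongrightarrow> 0)"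

section \<open>The space of square-integrable random fields\<close>

text \<open>The space \<open>L\<^sup>2(\<Omega>; L\<^sup>2(S2))\<close> in terms of jointly measurable representatives, and its norm.\<close>

definition L2_fields :: "'w measure \<Rightarrow> ('w \<Rightarrow> real ^ 3 \<Rightarrow> real) set" where
  "L2_fields M = {F. case_prod F \<in> borel_measurable (M \<Otimes>\<^sub>M S2_measure) \<and>
     integrable (M \<Otimes>\<^sub>M S2_measure) (\<lambda>(\<omega>, y). (F \<omega> y)\<^sup>2)}"

definition L2_S2_norm :: "(real ^ 3 \<Rightarrow> real) \<Rightarrow> real" where
  "L2_S2_norm f = sqrt (\<integral>y. (f y)\<^sup>2 \<partial>S2_measure)"

definition L2_field_norm :: "'w measure \<Rightarrow> ('w \<Rightarrow> real ^ 3 \<Rightarrow> real) \<Rightarrow> real" where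
  "L2_field_norm M F = sqrt (\<integral>\<omega>. (L2_S2_norm (F \<omega>))\<^sup>2 \<partial>M)"

end

theory Submission
  imports Defs
begin

text \<open>The random variables in the expansion are orthonormal in \<open>L\<^sup>2(\<Omega>)\<close>, so at a fixed point of the sphere
the terms of degree \<open>\<kappa> < l \<le> n\<close> have as second moment a sum of contributions
\<open>A l ((L_fun l 0 \<theta>)\<^sup>2 + 2 (\<Sum>m=1..l. (L_fun l m \<theta>)\<^sup>2))\<close>, one for each degree; the longitude drops out because
\<open>cos\<^sup>2 + sin\<^sup>2 = 1\<close>. At each point the truncated fields converge to \<open>T\<close> in probability. Fatou's
lemma along an almost surely convergent subsequence turns the second moments of the partial sums into a
bound on the second moment of \<open>T - T\<^sup>\<kappa>\<close> by the series of all contributions of degree \<open>l > \<kappa>\<close>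
(lemma \<open>KL_truncation_error_at_point\<close>).

The square of the norm in \<open>L\<^sup>2(\<Omega>; L\<^sup>2(S2))\<close> is the integral of this second moment over the sphere, by
Tonelli. Each function \<open>L_fun l m\<close> satisfies \<open>\<integral> (L_fun l m \<theta>)\<^sup>2 sin \<theta> d\<theta> = 1 / (2 \<pi>)\<close> on \<open>[0, \<pi>]\<close>
(\<open>has_integral_L_fun_sq\<close>), so degree \<open>l\<close> contributes \<open>A l (2 l + 1)\<close> after integration over the sphere. This
normalisation rests on the self-adjoint differential equation of the derivatives of the Legendre
polynomials and on a Beta integral.

Finally, the decay of the spectrum bounds the tail of \<open>\<Sum>l. A l (2 l + 1)\<close> by the constant in the
theorem times \<open>\<kappa>\<^bsup>2 - \<alpha>\<^esup>\<close> (\<open>angular_power_tail_le\<close>). Taking roots gives the rate, which tends to 0 as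
\<open>\<alpha> > 2\<close>.\<close>

section \<open>Normalisation of the associated Legendre functions\<close>

lemma higher_pderiv_eq_const:
  fixes p :: "real poly"
  assumes "degree p \<le> n"
  shows "(pderiv ^^ n) p = [:fact n * coeff p n:]"
proof (rule poly_eqI)
  fix k
  show "coeff ((pderiv ^^ n) p) k = coeff [:fact n * coeff p n:] k"
    using assms by (cases k) (auto simp: coeff_higher_pderiv pochhammer_fact intro: coeff_eq_0)
qed

lemma pderiv_funpow_smult:
  "(pderiv ^^ n) (smult c (p :: real poly)) = smult c ((pderiv ^^ n) p)"
  by (induction n) (simp_all add: pderiv_smult)

lemma higher_pderiv_legendre_poly:
  "(pderiv ^^ m) (legendre_poly l)
     = smult (1 / (2 ^ l * fact l)) ((pderiv ^^ (l + m)) ([:-1, 0, 1:] ^ l))"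
  by (simp add: legendre_poly_def pderiv_funpow_smult funpow_add add.commute[of l m])

lemma pderiv_top_legendre_poly:
  "(pderiv ^^ l) (legendre_poly l) = [:fact (2 * l) / (2 ^ l * fact l):]"
proof -
  let ?q = "[:-1, 0, 1:] :: real poly"
  have "degree (?q ^ l) = 2 * l"
    by (simp add: degree_power_eq)
  moreover have "coeff (?q ^ l) (2 * l) = 1"
    using lead_coeff_power[of ?q l] calculation by simp
  ultimately show ?thesis
    using higher_pderiv_eq_const[of "?q ^ l" "2 * l"]
    by (simp add: higher_pderiv_legendre_poly mult_2[symmetric])
qed


text \<open>The polynomial \<open>w = (x\<^sup>2 - 1)\<^sup>l\<close> satisfies \<open>(x\<^sup>2 - 1) w' = 2 l x w\<close>. Differentiating
this equation \<open>n + 1\<close> times by Leibniz' rule gives the claim; the induction on \<open>n\<close> applies one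
derivative at a time. Polynomial identities are verified pointwise, since \<open>algebra_simps\<close> is
effective on real numbers but not on the list representation of the weight \<open>x\<^sup>2 - 1\<close>.\<close>

lemma higher_pderiv_rodrigues:
  fixes l n :: nat
  defines "w \<equiv> [:-1, 0, 1:] ^ l :: real poly"
  shows "[:-1, 0, 1:] * (pderiv ^^ (n + 2)) w
      + smult (2 * (real n + 1 - real l)) ([:0, 1:] * (pderiv ^^ (n + 1)) w)
      + smult ((real n + 1) * (real n - 2 * real l)) ((pderiv ^^ n) w) = 0"
proof (induction n)
  case 0
  have "[:-1, 0, 1:] * pderiv w = smult (2 * real l) ([:0, 1:] * w)"
  proof (cases l)
    case (Suc k)
    show ?thesis
      unfolding w_def Suc pderiv_power_Suc
      by (intro poly_eq_poly_eq_iff[THEN iffD1] ext) (simp add: pderiv_pCons algebra_simps)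
  qed (simp add: w_def)
  then have "pderiv ([:-1, 0, 1:] * pderiv w) = pderiv (smult (2 * real l) ([:0, 1:] * w))"
    by (rule arg_cong)
  then have *: "[:-1, 0, 1:] * pderiv (pderiv w) + pderiv w * [:0, 2:]
      = smult (2 * real l) ([:0, 1:] * pderiv w + w * [:1:])"
    by (simp add: pderiv_mult pderiv_smult pderiv_pCons
        del: mult_pCons_left mult_pCons_right)
  have "poly ([:-1, 0, 1:] * pderiv (pderiv w) + pderiv w * [:0, 2:]) x
      = poly (smult (2 * real l) ([:0, 1:] * pderiv w + w * [:1:])) x" for x
    by (simp only: *)
  then show ?case
    by (intro poly_eq_poly_eq_iff[THEN iffD1] ext) (simp add: algebra_simps)
next
  case (Suc n)
  define D where "D k = (pderiv ^^ k) w" for k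
  have D: "pderiv (D k) = D (Suc k)" for k
    by (simp add: D_def)
  have "[:-1, 0, 1:] * D (n + 2) + smult (2 * (real n + 1 - real l)) ([:0, 1:] * D (n + 1))
      + smult ((real n + 1) * (real n - 2 * real l)) (D n) = 0"
    using Suc.IH unfolding D_def .
  then have "pderiv ([:-1, 0, 1:] * D (n + 2) + smult (2 * (real n + 1 - real l)) ([:0, 1:] * D (n + 1))
      + smult ((real n + 1) * (real n - 2 * real l)) (D n)) = 0"
    by simp
  then have *: "[:-1, 0, 1:] * D (n + 3) + D (n + 2) * [:0, 2:]
      + smult (2 * (real n + 1 - real l)) ([:0, 1:] * D (n + 2) + D (n + 1) * [:1:])
      + smult ((real n + 1) * (real n - 2 * real l)) (D (n + 1)) = 0"
    by (simp add: pderiv_mult pderiv_add pderiv_smult pderiv_pCons D numeral_3_eq_3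
        del: mult_pCons_left mult_pCons_right)
  have "poly ([:-1, 0, 1:] * D (n + 3) + D (n + 2) * [:0, 2:]
      + smult (2 * (real n + 1 - real l)) ([:0, 1:] * D (n + 2) + D (n + 1) * [:1:])
      + smult ((real n + 1) * (real n - 2 * real l)) (D (n + 1))) x = 0" for x
    by (simp only: * poly_0)
  then have "[:-1, 0, 1:] * D (Suc n + 2) + smult (2 * (real (Suc n) + 1 - real l)) ([:0, 1:] * D (Suc n + 1))
      + smult ((real (Suc n) + 1) * (real (Suc n) - 2 * real l)) (D (Suc n)) = 0"
    by (intro poly_eq_poly_eq_iff[THEN iffD1] ext) (simp add: algebra_simps numeral_3_eq_3)
  then show ?case
    unfolding D_def .
qed

text \<open>Since the Legendre polynomial is an \<open>l\<close>-th derivative of \<open>w\<close>, the differential equation of its \<open>m\<close>-th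
derivative \<open>D m\<close> is the previous recurrence at order \<open>l + m\<close>. Multiplication by \<open>(1 - x\<^sup>2)\<^sup>m\<close> puts it
into the self-adjoint form used for integration by parts.\<close>

lemma legendre_ode:
  fixes l m :: nat
  defines "D \<equiv> \<lambda>k. (pderiv ^^ k) (legendre_poly l)"
  shows "pderiv ([:1, 0, -1:] ^ Suc m * D (Suc m))
    = smult (- ((real l - real m) * (real l + real m + 1))) ([:1, 0, -1:] ^ m * D m)"
proof -
  define w where "w = (pderiv ^^ (l + m)) ([:-1, 0, 1:] ^ l :: real poly)"
  define c :: real where "c = 1 / (2 ^ l * fact l)"
  have D: "D m = smult c w" "D (Suc m) = smult c (pderiv w)" "pderiv (D (Suc m)) = smult c (pderiv (pderiv w))"
    by (simp_all add: D_def higher_pderiv_legendre_poly w_def c_def pderiv_smult)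
  have *: "[:-1, 0, 1:] * pderiv (pderiv w) + smult (2 * (real (l + m) + 1 - real l)) ([:0, 1:] * pderiv w)
      + smult ((real (l + m) + 1) * (real (l + m) - 2 * real l)) w = 0"
    using higher_pderiv_rodrigues[where l = l and n = "l + m"] by (simp add: w_def numeral_2_eq_2)
  have ode: "(x\<^sup>2 - 1) * poly (pderiv (pderiv w)) x + 2 * (real m + 1) * x * poly (pderiv w) x
      + (real l + real m + 1) * (real m - real l) * poly w x = 0" for x
    using arg_cong[OF *, of "\<lambda>p. poly p x"] by (simp add: algebra_simps power2_eq_square)
  have "poly (pderiv ([:1, 0, -1:] ^ Suc m * D (Suc m))) x
    = poly (smult (- ((real l - real m) * (real l + real m + 1))) ([:1, 0, -1:] ^ m * D m)) x" for x
  proof -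
    have "poly (pderiv ([:1, 0, -1:] ^ Suc m * D (Suc m))) x
      = - c * (1 - x\<^sup>2) ^ m * ((x\<^sup>2 - 1) * poly (pderiv (pderiv w)) x + 2 * (real m + 1) * x * poly (pderiv w) x)"
      unfolding pderiv_mult pderiv_power_Suc D(3)
      unfolding D
      by (simp add: pderiv_pCons algebra_simps power2_eq_square)
    also have "(x\<^sup>2 - 1) * poly (pderiv (pderiv w)) x + 2 * (real m + 1) * x * poly (pderiv w) x
        = - ((real l + real m + 1) * (real m - real l) * poly w x)"
      using ode[of x] by linarith
    finally show ?thesis
      unfolding D by (simp add: algebra_simps power2_eq_square)
  qed
  then show ?thesis
    by (intro poly_eq_poly_eq_iff[THEN iffD1] ext)
qed

text \<open>The integral of \<open>q\<close> over \<open>[-1, 1]\<close>, after the substitution \<open>x = cos \<theta>\<close>. The latter form is the one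
that the surface measure of the sphere produces.\<close>

definition zonal_integral :: "real poly \<Rightarrow> real" where
  "zonal_integral q = integral {0..pi} (\<lambda>\<theta>. poly q (cos \<theta>) * sin \<theta>)"

lemma has_integral_zonal:
  "((\<lambda>\<theta>. poly q (cos \<theta>) * sin \<theta>) has_integral zonal_integral q) {0..pi}"
  unfolding zonal_integral_def
  by (intro integrable_integral integrable_continuous_real continuous_intros)

lemma zonal_integral_add: "zonal_integral (p + q) = zonal_integral p + zonal_integral q"
proof (rule has_integral_unique[OF has_integral_zonal])
  show "((\<lambda>\<theta>. poly (p + q) (cos \<theta>) * sin \<theta>) has_integral zonal_integral p + zonal_integral q) {0..pi}"
    using has_integral_add[OF has_integral_zonal[of p] has_integral_zonal[of q]]
    by (simp add: algebra_simps)
qed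

lemma zonal_integral_smult: "zonal_integral (smult c p) = c * zonal_integral p"
  unfolding zonal_integral_def
  by (simp add: mult.assoc)

lemma zonal_integral_pderiv: "zonal_integral (pderiv q) = poly q 1 - poly q (-1)"
proof (rule has_integral_unique[OF has_integral_zonal])
  have "((\<lambda>\<theta>. poly (pderiv q) (cos \<theta>) * sin \<theta>) has_integral (- poly q (cos pi) - - poly q (cos 0))) {0..pi}"
  proof (rule fundamental_theorem_of_calculus)
    show "((\<lambda>\<theta>. - poly q (cos \<theta>)) has_vector_derivative poly (pderiv q) (cos x) * sin x) (at x within {0..pi})" for x
      unfolding has_real_derivative_iff_has_vector_derivative[symmetric]
      by (auto intro!: derivative_eq_intros)
  qed simp
  then show "((\<lambda>\<theta>. poly (pderiv q) (cos \<theta>) * sin \<theta>) has_integral poly q 1 - poly q (-1)) {0..pi}"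
    by simp
qed

lemma zonal_integral_by_parts:
  assumes "poly p 1 = 0" "poly p (-1) = 0"
  shows "zonal_integral (q * pderiv p) = - zonal_integral (p * pderiv q)"
  using zonal_integral_pderiv[of "p * q"] assms
  by (simp add: pderiv_mult zonal_integral_add)

text \<open>The Beta integral of \<open>(1 - x\<^sup>2)\<^sup>n\<close>. Its recursion in \<open>n\<close> comes from integrating the derivative of
\<open>x (1 - x\<^sup>2)\<^bsup>n+1\<^esup>\<close>, which vanishes at both end points.\<close>

lemma zonal_integral_weight:
  "zonal_integral ([:1, 0, -1:] ^ n) = 2 * 4 ^ n * (fact n)\<^sup>2 / fact (2 * n + 1)"
proof (induction n)
  case 0
  show ?case
    using zonal_integral_pderiv[of "[:0, 1:]"] by (simp add: pderiv_pCons one_pCons)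
next
  case (Suc n)
  let ?u = "[:1, 0, -1:] :: real poly"
  have "pderiv ([:0, 1:] * ?u ^ Suc n) = smult (2 * real n + 3) (?u ^ Suc n) + smult (- (2 * real n + 2)) (?u ^ n)"
    by (intro poly_eq_poly_eq_iff[THEN iffD1] ext, unfold pderiv_mult pderiv_power_Suc)
      (simp add: pderiv_pCons algebra_simps power2_eq_square)
  from arg_cong[OF this, of zonal_integral]
  have "(2 * real n + 3) * zonal_integral (?u ^ Suc n) + - (2 * real n + 2) * zonal_integral (?u ^ n)
      = poly ([:0, 1:] * ?u ^ Suc n) 1 - poly ([:0, 1:] * ?u ^ Suc n) (- 1)"
    by (simp only: zonal_integral_pderiv zonal_integral_add zonal_integral_smult)
  also have "\<dots> = 0"
    by simp
  finally have "(2 * real n + 3) * zonal_integral (?u ^ Suc n) = (2 * real n + 2) * zonal_integral (?u ^ n)"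
    by linarith
  then have "zonal_integral (?u ^ Suc n) = (2 * real n + 2) * zonal_integral (?u ^ n) / (2 * real n + 3)"
    by (subst eq_divide_eq) (simp only: mult.commute, simp)
  also have "\<dots> = (2 * real n + 2) * (2 * 4 ^ n * (fact n)\<^sup>2 / fact (2 * n + 1)) / (2 * real n + 3)"
    by (simp only: Suc.IH)
  also have "\<dots> = 2 * 4 ^ Suc n * (fact (Suc n))\<^sup>2 / fact (2 * Suc n + 1)"
  proof -
    have f: "fact (2 * Suc n + 1) = (2 * real n + 3) * ((2 * real n + 2) * fact (2 * n + 1))"
      by (simp add: algebra_simps)
    show ?thesis
      unfolding f by (simp add: divide_simps power2_eq_square) (simp add: algebra_simps)
  qed
  finally show ?case .
qed

text \<open>Normalisation of the associated Legendre functions, by downward induction on \<open>m\<close>. For \<open>m = l\<close> the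
derivative of the Legendre polynomial is constant and only a Beta integral remains. Integration by
parts and the differential equation show that the integral at \<open>m + 1\<close> is \<open>(l - m) (l + m + 1)\<close> times
the integral at \<open>m\<close>; the quotient of factorials obeys the same recursion. Starting at the top avoids
the separate computation of the norm of the Legendre polynomial itself.\<close>

lemma zonal_integral_assoc_legendre:
  assumes "m \<le> l"
  shows "zonal_integral ([:1, 0, -1:] ^ m * ((pderiv ^^ m) (legendre_poly l))\<^sup>2)
    = 2 / (2 * real l + 1) * (fact (l + m) / fact (l - m))"
  using assms
proof (induction rule: inc_induct)
  case base
  define c :: real where "c = fact (2 * l) / (2 ^ l * fact l)"
  have "[:1, 0, -1:] ^ l * ((pderiv ^^ l) (legendre_poly l))\<^sup>2 = smult (c\<^sup>2) ([:1, 0, -1:] ^ l)"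
    by (simp add: pderiv_top_legendre_poly c_def[symmetric] power2_eq_square)
  then have "zonal_integral ([:1, 0, -1:] ^ l * ((pderiv ^^ l) (legendre_poly l))\<^sup>2)
      = c\<^sup>2 * (2 * 4 ^ l * (fact l)\<^sup>2 / fact (2 * l + 1))"
    by (simp only: zonal_integral_smult zonal_integral_weight)
  also have "\<dots> = 2 * fact (2 * l) / (2 * real l + 1)"
  proof -
    have "fact (2 * l + 1) = (2 * real l + 1) * fact (2 * l)"
      by simp
    moreover have "(4::real) ^ l = 2 ^ l * 2 ^ l"
      by (simp flip: power_mult_distrib)
    ultimately show ?thesis
      by (simp add: c_def divide_simps power2_eq_square)
  qed
  also have "\<dots> = 2 / (2 * real l + 1) * (fact (l + l) / fact (l - l))"
    by (simp flip: mult_2)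
  finally show ?case .
next
  case (step m)
  define D where "D k = (pderiv ^^ k) (legendre_poly l)" for k
  (* The weight gets a name so that simplification does not expand its powers coefficientwise. *)
  define u where "u = ([:1, 0, -1:] :: real poly)"
  have u: "poly (u ^ Suc m * D (Suc m)) 1 = 0" "poly (u ^ Suc m * D (Suc m)) (- 1) = 0"
    by (simp_all add: u_def)
  have D: "D (Suc m) = pderiv (D m)"
    by (simp add: D_def)
  have ode: "pderiv (u ^ Suc m * D (Suc m)) = smult (- ((real l - real m) * (real l + real m + 1))) (u ^ m * D m)"
    unfolding u_def D_def by (rule legendre_ode)
  have "zonal_integral (u ^ Suc m * (D (Suc m))\<^sup>2) = zonal_integral (u ^ Suc m * D (Suc m) * pderiv (D m))"
    by (simp only: D power2_eq_square mult.assoc)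
  also have "\<dots> = - zonal_integral (D m * pderiv (u ^ Suc m * D (Suc m)))"
    using zonal_integral_by_parts[OF u, of "D m"] by simp
  also have "D m * pderiv (u ^ Suc m * D (Suc m))
      = smult (- ((real l - real m) * (real l + real m + 1))) (u ^ m * (D m)\<^sup>2)"
    by (simp only: ode power2_eq_square mult_smult_right mult.left_commute)
  finally have "zonal_integral (u ^ Suc m * (D (Suc m))\<^sup>2)
      = (real l - real m) * (real l + real m + 1) * zonal_integral (u ^ m * (D m)\<^sup>2)"
    unfolding zonal_integral_smult by simp
  moreover have "real l - real m > 0" "real l + real m + 1 > 0"
    using step.hyps by simp_all
  ultimately have "zonal_integral (u ^ m * (D m)\<^sup>2)
      = zonal_integral (u ^ Suc m * (D (Suc m))\<^sup>2) / ((real l - real m) * (real l + real m + 1))"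
    by simp
  also have "\<dots> = 2 / (2 * real l + 1) * (fact (l + Suc m) / fact (l - Suc m)) / ((real l - real m) * (real l + real m + 1))"
    using step.IH by (simp only: D_def u_def)
  also have "fact (l + Suc m) = (real l + real m + 1) * fact (l + m)"
    by simp
  also have "fact (l - Suc m) = fact (l - m) / (real l - real m)"
  proof -
    have "l - m = Suc (l - Suc m)"
      using step.hyps by simp
    then have "fact (l - m) = real (l - m) * fact (l - Suc m)"
      by (metis fact_Suc)
    then show ?thesis
      using step.hyps by (simp add: of_nat_diff)
  qed
  also have "2 / (2 * real l + 1) * ((real l + real m + 1) * fact (l + m) / (fact (l - m) / (real l - real m)))
      / ((real l - real m) * (real l + real m + 1))
      = 2 / (2 * real l + 1) * (fact (l + m) / fact (l - m))"
    using \<open>real l - real m > 0\<close> \<open>real l + real m + 1 > 0\<close> by simp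
  finally show ?case
    by (simp only: D_def u_def)
qed

text \<open>The factor in the definition of \<open>L_fun\<close> is chosen so that, after multiplication by the length \<open>2 \<pi>\<close>
of the range of the longitude, the spherical harmonics have norm 1.\<close>

lemma has_integral_L_fun_sq:
  assumes "m \<le> l"
  shows "((\<lambda>\<theta>. (L_fun l m \<theta>)\<^sup>2 * sin \<theta>) has_integral 1 / (2 * pi)) {0..pi}"
proof -
  define p where "p = [:1, 0, -1:] ^ m * ((pderiv ^^ m) (legendre_poly l))\<^sup>2"
  define c :: real where "c = (2 * real l + 1) / (4 * pi) * (fact (l - m) / fact (l + m))"
  have "c \<ge> 0"
    by (simp add: c_def)
  have "(L_fun l m \<theta>)\<^sup>2 = poly (smult c p) (cos \<theta>)" for \<theta>
  proof -
    have "(sqrt (1 - (cos \<theta>)\<^sup>2) ^ m)\<^sup>2 = (1 - (cos \<theta>)\<^sup>2) ^ m"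
      by (simp add: power_mult_distrib[symmetric] abs_square_le_1 flip: power_mult) 
        (simp add: mult.commute[of m] power_mult abs_square_le_1)
    moreover have "((- 1) ^ m)\<^sup>2 = (1::real)"
      by (simp flip: power_mult add: mult.commute[of m])
    ultimately show ?thesis
      using \<open>c \<ge> 0\<close>
      unfolding L_fun_def assoc_legendre_def c_def[symmetric] power_mult_distrib p_def
      by (simp add: power2_eq_square)
  qed
  moreover have "zonal_integral (smult c p) = 1 / (2 * pi)"
    using assms by (simp add: zonal_integral_smult p_def zonal_integral_assoc_legendre c_def)
  ultimately show ?thesis
    using has_integral_zonal[of "smult c p"] by simp
qed

section \<open>Integration of zonal functions over the sphere\<close>

lemma sph_point_measurable [measurable]:
  "(\<lambda>(\<theta>, \<phi>). sph_point \<theta> \<phi>) \<in> borel_measurable borel"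
proof -
  define g where "g i p = (if i = 1 then sin (fst p) * cos (snd p)
    else if i = 2 then sin (fst p) * sin (snd p) else cos (fst p))" for i :: 3 and p :: "real \<times> real"
  have "continuous_on UNIV (g i)" for i
    unfolding g_def by (cases "i = 1"; cases "i = 2") (simp_all add: continuous_intros)
  then have "continuous_on UNIV (\<lambda>p. \<chi> i. g i p)"
    by (rule continuous_on_vec_lambda)
  also have "(\<lambda>p. \<chi> i. g i p) = (\<lambda>p. sph_point (fst p) (snd p))"
    by (auto simp: g_def sph_point_def vec_eq_iff forall_3)
  finally have "continuous_on UNIV (\<lambda>p. sph_point (fst p) (snd p))" .
  then show ?thesis
    by (simp add: case_prod_beta' borel_measurable_continuous_onI)
qed

lemma colatitude_sph_point:
  assumes "\<theta> \<in> {0..pi}"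
  shows "colatitude (sph_point \<theta> \<phi>) = \<theta>"
  using assms by (simp add: colatitude_def sph_point_def arccos_cos)

lemma colatitude_measurable [measurable]: "colatitude \<in> borel_measurable (restrict_space borel S2)"
proof (rule borel_measurable_continuous_on_restrict)
  show "continuous_on S2 colatitude"
    unfolding colatitude_def
  proof (rule continuous_on_arccos)
    show "\<forall>y\<in>S2. - 1 \<le> y $ 3 \<and> y $ 3 \<le> 1"
    proof
      fix y :: "real ^ 3" assume "y \<in> S2"
      then have "\<bar>y $ 3\<bar> \<le> 1"
        using component_le_norm_cart[of y 3] by simp
      then show "- 1 \<le> y $ 3 \<and> y $ 3 \<le> 1"
        by linarith
    qed
  qed (intro continuous_intros)
qed

text \<open>Functions of the colatitude alone suffice: the variances to be integrated do not depend on the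
longitude, whose integration contributes the factor \<open>2 \<pi>\<close>.\<close>

lemma nn_integral_S2_measure_zonal:
  fixes f :: "real \<Rightarrow> real"
  assumes [measurable]: "f \<in> borel_measurable borel"
    and nonneg: "\<And>\<theta>. 0 \<le> f \<theta>"
    and int: "((\<lambda>\<theta>. f \<theta> * sin \<theta>) has_integral c) {0..pi}"
  shows "(\<integral>\<^sup>+y. ennreal (f (colatitude y)) \<partial>S2_measure) = ennreal (2 * pi * c)"
proof -
  have colat: "(\<lambda>y. f (colatitude y)) \<in> borel_measurable (restrict_space borel S2)"
    by measurable
  have s [measurable]: "(\<lambda>(\<theta>, \<phi>). sph_point \<theta> \<phi>) \<in> measurable lborel (restrict_space borel S2)"
    using sph_point_in_S2 by (auto intro!: measurable_restrict_space2)
  have "(\<integral>\<^sup>+y. ennreal (f (colatitude y)) \<partial>S2_measure)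
      = (\<integral>\<^sup>+p. ennreal (indicator ({0..pi} \<times> {0..<2 * pi}) p * sin (fst p))
          * ennreal (f (colatitude (sph_point (fst p) (snd p)))) \<partial>lborel)"
  proof -
    let ?d = "density lborel (\<lambda>(\<theta>, \<phi>). ennreal (indicator ({0..pi} \<times> {0..<2 * pi}) (\<theta>, \<phi>) * sin \<theta>))"
    have [measurable]: "(\<lambda>p. f (colatitude (sph_point (fst p) (snd p)))) \<in> borel_measurable lborel"
      using measurable_compose[OF s colat] by (simp add: case_prod_beta')
    have "(\<integral>\<^sup>+y. ennreal (f (colatitude y)) \<partial>S2_measure)
        = (\<integral>\<^sup>+p. ennreal (f (colatitude (case p of (\<theta>, \<phi>) \<Rightarrow> sph_point \<theta> \<phi>))) \<partial>?d)"
      unfolding S2_measure_def using s colat by (intro nn_integral_distr) simp_all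
    also have "\<dots> = (\<integral>\<^sup>+p. (case p of (\<theta>, \<phi>) \<Rightarrow> ennreal (indicator ({0..pi} \<times> {0..<2 * pi}) (\<theta>, \<phi>) * sin \<theta>))
        * ennreal (f (colatitude (case p of (\<theta>, \<phi>) \<Rightarrow> sph_point \<theta> \<phi>))) \<partial>lborel)"
    proof (rule nn_integral_density)
      show "(\<lambda>(\<theta>, \<phi>). ennreal (indicator ({0..pi} \<times> {0..<2 * pi}) (\<theta>, \<phi>) * sin \<theta>)) \<in> borel_measurable lborel"
        by (simp add: case_prod_beta' flip: lborel_prod)
    qed (simp add: case_prod_beta')
    finally show ?thesis
      by (simp add: case_prod_beta')
  qed
  also have "\<dots> = (\<integral>\<^sup>+p. ennreal (indicator {0..pi} (fst p) * (f (fst p) * sin (fst p))) * indicator {0..<2 * pi} (snd p)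
      \<partial>(lborel \<Otimes>\<^sub>M lborel))"
    unfolding lborel_prod
    by (intro nn_integral_cong)
      (auto simp: indicator_def colatitude_sph_point nonneg sin_ge_zero ennreal_mult[symmetric] mult.commute)
  also have "\<dots> = (\<integral>\<^sup>+\<theta>. \<integral>\<^sup>+\<phi>. ennreal (indicator {0..pi} \<theta> * (f \<theta> * sin \<theta>)) * indicator {0..<2 * pi} \<phi> \<partial>lborel \<partial>lborel)"
    by (subst lborel.nn_integral_fst[symmetric]) auto
  also have "\<dots> = (\<integral>\<^sup>+\<theta>. ennreal (indicator {0..pi} \<theta> * (f \<theta> * sin \<theta>)) * ennreal (2 * pi) \<partial>lborel)"
    by (simp add: nn_integral_cmult)
  also have "\<dots> = (\<integral>\<^sup>+\<theta>. ennreal (indicator {0..pi} \<theta> * (f \<theta> * sin \<theta>)) \<partial>lborel) * ennreal (2 * pi)"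
    by (rule nn_integral_multc) auto
  also have "(\<integral>\<^sup>+\<theta>. ennreal (indicator {0..pi} \<theta> * (f \<theta> * sin \<theta>)) \<partial>lborel) = ennreal c"
  proof -
    have "(\<lambda>\<theta>. indicator {0..pi} \<theta> * (f \<theta> * sin \<theta>)) = (\<lambda>\<theta>. if \<theta> \<in> {0..pi} then f \<theta> * sin \<theta> else 0)"
      by (auto simp: indicator_def)
    then have "((\<lambda>\<theta>. indicator {0..pi} \<theta> * (f \<theta> * sin \<theta>)) has_integral c) UNIV"
      using int by (simp only: has_integral_restrict_UNIV)
    then show ?thesis
      using nn_integral_has_integral_lborel[of "\<lambda>\<theta>. indicator {0..pi} \<theta> * (f \<theta> * sin \<theta>)" c] nonneg
      by (auto simp: indicator_def sin_ge_zero)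
  qed
  also have "ennreal c * ennreal (2 * pi) = ennreal (2 * pi * c)"
    by (metis ennreal_mult' mult.commute mult_nonneg_nonneg pi_ge_zero zero_le_numeral)
  finally show ?thesis .
qed

text \<open>The argument jumps across the nonnegative real half-line, where it is 0 by convention, and it is
continuous on the complement.\<close>

lemma Arg2pi_measurable [measurable]: "Arg2pi \<in> borel_measurable borel"
proof -
  have m: "{z \<in> space borel. z \<in> (\<real>\<^sub>\<ge>\<^sub>0 :: complex set)} \<in> sets borel"
    using closed_nonneg_Reals_complex by (simp add: borel_closed)
  have "continuous_on {z. z \<notin> \<real>\<^sub>\<ge>\<^sub>0} Arg2pi"
    by (auto intro!: continuous_at_imp_continuous_on continuous_at_Arg2pi)
  then have "Arg2pi \<in> borel_measurable (restrict_space borel {z. z \<notin> \<real>\<^sub>\<ge>\<^sub>0})"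
    by (rule borel_measurable_continuous_on_restrict)
  then have "(\<lambda>z. if z \<in> \<real>\<^sub>\<ge>\<^sub>0 then 0 else Arg2pi z) \<in> borel_measurable borel"
    using measurable_If_restrict_space_iff[OF m, of "\<lambda>_. 0" Arg2pi borel] by simp
  also have "(\<lambda>z. if z \<in> \<real>\<^sub>\<ge>\<^sub>0 then 0 else Arg2pi z) = Arg2pi"
    by (auto simp: Arg2pi_eq_0 complex_nonneg_Reals_iff complex_is_Real_iff)
  finally show ?thesis .
qed

lemma longitude_measurable [measurable]: "longitude \<in> borel_measurable (restrict_space borel S2)"
proof -
  have "(\<lambda>y::real^3. Complex (y $ 1) (y $ 2)) \<in> borel_measurable borel"
    by (intro borel_measurable_continuous_onI) (simp add: Complex_eq, intro continuous_intros)
  then have "longitude \<in> borel_measurable borel"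
    unfolding longitude_def by measurable
  then show ?thesis
    by (rule measurable_restrict_space1)
qed

lemma L_fun_measurable [measurable]: "L_fun l m \<in> borel_measurable borel"
  unfolding L_fun_def[abs_def] assoc_legendre_def
  by (intro borel_measurable_continuous_onI continuous_intros)

lemma finite_measure_S2_measure: "finite_measure S2_measure"
proof
  have "((\<lambda>\<theta>. 1 * sin \<theta>) has_integral 2) {0..pi}"
    using has_integral_zonal[of "[:1:]"] zonal_integral_pderiv[of "[:0, 1:]"]
    by (simp add: pderiv_pCons)
  then have "(\<integral>\<^sup>+y. ennreal 1 \<partial>S2_measure) = ennreal (2 * pi * 2)"
    by (intro nn_integral_S2_measure_zonal[where f = "\<lambda>_. 1"]) auto
  then have "emeasure S2_measure (space S2_measure) = ennreal (2 * pi * 2)"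
    by (simp only: ennreal_1 nn_integral_const mult_1)
  then show "emeasure S2_measure (space S2_measure) \<noteq> \<infinity>"
    by simp
qed

section \<open>Second moments and limits in probability\<close>

lemma (in prob_space) iid_standard_normal_orthonormal:
  assumes "iid_standard_normal M X" "j \<in> KL_index" "k \<in> KL_index"
  defines "Y \<equiv> \<lambda>(i, l, m). X i l m"
  shows "random_variable borel (Y j)"
    and "integrable M (\<lambda>\<omega>. Y j \<omega> * Y k \<omega>)"
    and "expectation (\<lambda>\<omega>. Y j \<omega> * Y k \<omega>) = (if j = k then 1 else 0)"
proof -
  have indep: "indep_vars (\<lambda>_. borel) Y KL_index"
    using assms by (simp add: iid_standard_normal_def)
  have d: "distributed M lborel (Y i) std_normal_density" if "i \<in> KL_index" for i
    using assms(1) that by (auto simp: iid_standard_normal_def Y_def)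
  show "random_variable borel (Y j)"
    using distributed_measurable[OF d[OF assms(2)]] by simp
  have int: "integrable M (Y i)" if "i \<in> KL_index" for i
    using distributed_integrable[OF d[OF that], of "\<lambda>x. x"] integrable_std_normal_moment[of 1] by simp
  have int2: "integrable M (\<lambda>\<omega>. (Y i \<omega>)\<^sup>2)" if "i \<in> KL_index" for i
    using distributed_integrable[OF d[OF that], of "\<lambda>x. x\<^sup>2"] integrable_std_normal_moment[of 2] by simp
  have zero: "expectation (Y i) = 0" if "i \<in> KL_index" for i
    using standard_normal_distributed_expectation[OF d[OF that]] .
  have one: "expectation (\<lambda>\<omega>. (Y i \<omega>)\<^sup>2) = 1" if "i \<in> KL_index" for i
    using standard_normal_distributed_variance[OF d[OF that]] zero[OF that] by simp
  have "integrable M (\<lambda>\<omega>. Y j \<omega> * Y k \<omega>) \<and> expectation (\<lambda>\<omega>. Y j \<omega> * Y k \<omega>) = (if j = k then 1 else 0)"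
  proof (cases "j = k")
    case True
    then show ?thesis
      using int2[OF assms(2)] one[OF assms(2)] by (simp add: power2_eq_square)
  next
    case False
    have "indep_vars (\<lambda>_. borel) Y {j, k}"
      by (rule indep_vars_subset[OF indep]) (use assms in auto)
    then show ?thesis
      using indep_vars_integrable[of "{j, k}" Y] indep_vars_lebesgue_integral[of "{j, k}" Y] int zero assms False
      by auto
  qed
  then show "integrable M (\<lambda>\<omega>. Y j \<omega> * Y k \<omega>)"
    "expectation (\<lambda>\<omega>. Y j \<omega> * Y k \<omega>) = (if j = k then 1 else 0)"
    by auto
qed

lemma nn_integral_square_orthonormal_sum:
  fixes Y :: "'i \<Rightarrow> 'w \<Rightarrow> real" and c :: "'i \<Rightarrow> real"
  assumes "finite J"
    and int: "\<And>j k. j \<in> J \<Longrightarrow> k \<in> J \<Longrightarrow> integrable M (\<lambda>\<omega>. Y j \<omega> * Y k \<omega>)"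
    and orth: "\<And>j k. j \<in> J \<Longrightarrow> k \<in> J \<Longrightarrow> (\<integral>\<omega>. Y j \<omega> * Y k \<omega> \<partial>M) = (if j = k then 1 else 0)"
  shows "(\<integral>\<^sup>+\<omega>. ennreal ((\<Sum>j\<in>J. c j * Y j \<omega>)\<^sup>2) \<partial>M) = ennreal (\<Sum>j\<in>J. (c j)\<^sup>2)"
proof -
  have sq: "(\<Sum>j\<in>J. c j * Y j \<omega>)\<^sup>2 = (\<Sum>j\<in>J. \<Sum>k\<in>J. (c j * c k) * (Y j \<omega> * Y k \<omega>))" for \<omega>
    by (simp add: power2_eq_square sum_product mult_ac)
  have "integrable M (\<lambda>\<omega>. (\<Sum>j\<in>J. c j * Y j \<omega>)\<^sup>2)"
    unfolding sq by (intro Bochner_Integration.integrable_sum integrable_mult_right int)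
  then have "(\<integral>\<^sup>+\<omega>. ennreal ((\<Sum>j\<in>J. c j * Y j \<omega>)\<^sup>2) \<partial>M) = ennreal (\<integral>\<omega>. (\<Sum>j\<in>J. c j * Y j \<omega>)\<^sup>2 \<partial>M)"
    by (intro nn_integral_eq_integral) auto
  also have "(\<integral>\<omega>. (\<Sum>j\<in>J. c j * Y j \<omega>)\<^sup>2 \<partial>M) = (\<Sum>j\<in>J. \<Sum>k\<in>J. (c j * c k) * (if j = k then 1 else 0))"
    unfolding sq
    by (subst Bochner_Integration.integral_sum, (intro Bochner_Integration.integrable_sum integrable_mult_right int; assumption),
        intro sum.cong refl, subst Bochner_Integration.integral_sum)
      (auto intro!: sum.cong int simp: orth)
  also have "\<dots> = (\<Sum>j\<in>J. (c j)\<^sup>2)"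
    using \<open>finite J\<close> by (intro sum.cong refl) (simp add: if_distrib sum.delta power2_eq_square cong: if_cong)
  finally show ?thesis .
qed

text \<open>A uniform bound on the second moments of \<open>Y n - Z\<close> is inherited by the limit \<open>U\<close> in probability:
along a subsequence the convergence is almost sure, and Fatou's lemma applies. The subsequence is
found by noting that \<open>min 1 \<bar>U - Y n\<bar>\<close> tends to 0 in \<open>L\<^sup>1\<close>.\<close>

lemma (in prob_space) nn_integral_square_limit_in_probability:
  fixes Y :: "nat \<Rightarrow> 'a \<Rightarrow> real" and U Z :: "'a \<Rightarrow> real"
  assumes [measurable]: "\<And>n. Y n \<in> borel_measurable M" "U \<in> borel_measurable M" "Z \<in> borel_measurable M"
    and conv: "\<And>\<epsilon>. \<epsilon> > 0 \<Longrightarrow> (\<lambda>n. prob {\<omega> \<in> space M. \<bar>U \<omega> - Y n \<omega>\<bar> > \<epsilon>}) \<longlonglongrightarrow> 0"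
    and bound: "\<And>n. n \<ge> k \<Longrightarrow> (\<integral>\<^sup>+\<omega>. ennreal ((Y n \<omega> - Z \<omega>)\<^sup>2) \<partial>M) \<le> B"
  shows "(\<integral>\<^sup>+\<omega>. ennreal ((U \<omega> - Z \<omega>)\<^sup>2) \<partial>M) \<le> B"
proof -
  define d where "d n \<omega> = min 1 \<bar>U \<omega> - Y n \<omega>\<bar>" for n \<omega>
  have [measurable]: "d n \<in> borel_measurable M" for n
    unfolding d_def[abs_def] by measurable
  have int: "integrable M (d n)" for n
    by (rule integrable_const_bound[where B = 1]) (auto simp: d_def)
  have "(\<lambda>n. expectation (d n)) \<longlonglongrightarrow> 0"
  proof (rule LIMSEQ_I)
    fix e :: real assume "e > 0"
    then have "e / 2 > 0" by simp
    from order_tendstoD(2)[OF conv[OF this] this]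
    obtain N where N: "prob {\<omega> \<in> space M. \<bar>U \<omega> - Y n \<omega>\<bar> > e / 2} < e / 2" if "n \<ge> N" for n
      by (auto simp: eventually_sequentially)
    have "norm (expectation (d n) - 0) < e" if "n \<ge> N" for n
    proof -
      let ?A = "{\<omega> \<in> space M. \<bar>U \<omega> - Y n \<omega>\<bar> > e / 2}"
      have intA: "integrable M (indicator ?A :: 'a \<Rightarrow> real)"
        by (intro integrable_real_indicator) (auto simp: less_top[symmetric])
      have "expectation (d n) \<le> expectation (\<lambda>\<omega>. e / 2 + indicator ?A \<omega>)"
      proof (rule integral_mono[OF int])
        show "integrable M (\<lambda>\<omega>. e / 2 + indicator ?A \<omega>)"
          using intA by simp
      qed (use \<open>e > 0\<close> in \<open>auto simp: d_def indicator_def min_def\<close>)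
      also have "\<dots> = e / 2 + prob ?A"
        by (subst Bochner_Integration.integral_add) (use intA in \<open>auto simp: prob_space\<close>)
      also have "\<dots> < e"
        using N[OF that] by simp
      finally show ?thesis
        using Bochner_Integration.integral_nonneg[of M "d n"] by (simp add: d_def)
    qed
    then show "\<exists>N. \<forall>n\<ge>N. norm (expectation (d n) - 0) < e"
      by blast
  qed
  then have "(\<lambda>n. expectation (\<lambda>\<omega>. norm (d n \<omega>))) \<longlonglongrightarrow> 0"
    by (simp add: d_def[abs_def])
  from tendsto_L1_AE_subseq[OF int this]
  obtain r where r: "strict_mono r" and lim: "AE \<omega> in M. (\<lambda>n. d (r n) \<omega>) \<longlonglongrightarrow> 0"
    by blast
  have "AE \<omega> in M. ennreal ((U \<omega> - Z \<omega>)\<^sup>2) = liminf (\<lambda>n. ennreal ((Y (r n) \<omega> - Z \<omega>)\<^sup>2))"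
    using lim
  proof eventually_elim
    case (elim \<omega>)
    have "eventually (\<lambda>n. d (r n) \<omega> < 1) sequentially"
      using order_tendstoD(2)[OF elim] by simp
    then have "eventually (\<lambda>n. d (r n) \<omega> = \<bar>U \<omega> - Y (r n) \<omega>\<bar>) sequentially"
      by eventually_elim (auto simp: d_def)
    with elim have "(\<lambda>n. \<bar>U \<omega> - Y (r n) \<omega>\<bar>) \<longlonglongrightarrow> 0"
      by (rule Lim_transform_eventually)
    then have "(\<lambda>n. U \<omega> - (U \<omega> - Y (r n) \<omega>)) \<longlonglongrightarrow> U \<omega> - 0"
      by (intro tendsto_intros) (simp add: tendsto_rabs_zero_iff)
    then have "(\<lambda>n. ennreal ((Y (r n) \<omega> - Z \<omega>)\<^sup>2)) \<longlonglongrightarrow> ennreal ((U \<omega> - Z \<omega>)\<^sup>2)"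
      by (intro tendsto_intros) simp
    then show ?case
      by (rule lim_imp_Liminf[OF trivial_limit_sequentially, symmetric])
  qed
  then have "(\<integral>\<^sup>+\<omega>. ennreal ((U \<omega> - Z \<omega>)\<^sup>2) \<partial>M) = (\<integral>\<^sup>+\<omega>. liminf (\<lambda>n. ennreal ((Y (r n) \<omega> - Z \<omega>)\<^sup>2)) \<partial>M)"
    by (rule nn_integral_cong_AE)
  also have "\<dots> \<le> liminf (\<lambda>n. \<integral>\<^sup>+\<omega>. ennreal ((Y (r n) \<omega> - Z \<omega>)\<^sup>2) \<partial>M)"
    by (rule nn_integral_liminf) measurable
  also have "\<dots> \<le> liminf (\<lambda>n. B)"
  proof (rule Liminf_mono)
    show "eventually (\<lambda>n. (\<integral>\<^sup>+\<omega>. ennreal ((Y (r n) \<omega> - Z \<omega>)\<^sup>2) \<partial>M) \<le> B) sequentially"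
      using eventually_ge_at_top[of k]
      by eventually_elim (use seq_suble[OF r] bound order_trans in blast)
  qed
  finally show ?thesis
    by (simp add: Liminf_const)
qed

section \<open>Tails of the angular power series\<close>

text \<open>The mean value theorem for \<open>t powr (1 - p)\<close> on \<open>[x - 1, x]\<close> yields a telescoping majorant, which
replaces the comparison of the series with an integral.\<close>

lemma powr_le_telescope:
  fixes x p :: real
  assumes "x > 1" "p > 1"
  shows "x powr (- p) \<le> ((x - 1) powr (1 - p) - x powr (1 - p)) / (p - 1)"
proof -
  have "((\<lambda>t. t powr (1 - p)) has_real_derivative (1 - p) * t powr (1 - p - 1)) (at t)" if "x - 1 \<le> t" for t
    using assms that by (intro has_real_derivative_powr) auto
  then have "\<exists>z. x - 1 < z \<and> z < x
      \<and> x powr (1 - p) - (x - 1) powr (1 - p) = (x - (x - 1)) * ((1 - p) * z powr (1 - p - 1))"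
    by (intro MVT2) auto
  then obtain z where z: "x - 1 < z" "z < x"
    and eq: "x powr (1 - p) - (x - 1) powr (1 - p) = (x - (x - 1)) * ((1 - p) * z powr (1 - p - 1))"
    by blast
  have "x powr (- p) \<le> z powr (- p)"
    using z assms by (intro powr_mono2') auto
  also have "z powr (- p) = ((x - 1) powr (1 - p) - x powr (1 - p)) / (p - 1)"
    using eq assms by (simp add: field_simps)
  finally show ?thesis .
qed

lemma sum_powr_tail_le:
  fixes p :: real
  assumes "p > 1" "\<kappa> \<ge> 1"
  shows "(\<Sum>l<n. real (l + Suc \<kappa>) powr (- p)) \<le> real \<kappa> powr (1 - p) / (p - 1)"
proof -
  have "(\<Sum>l<n. real (l + Suc \<kappa>) powr (- p))
      \<le> (real \<kappa> powr (1 - p) - real (n + \<kappa>) powr (1 - p)) / (p - 1)"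
  proof (induction n)
    case (Suc n)
    have "real (n + Suc \<kappa>) powr (- p)
        \<le> (real (n + \<kappa>) powr (1 - p) - real (Suc n + \<kappa>) powr (1 - p)) / (p - 1)"
      using powr_le_telescope[of "real (n + Suc \<kappa>)" p] assms by (simp add: add_ac)
    with Suc.IH show ?case
      by (simp add: diff_divide_distrib)
  qed simp
  also have "\<dots> \<le> real \<kappa> powr (1 - p) / (p - 1)"
    using assms by (intro divide_right_mono) auto
  finally show ?thesis .
qed

text \<open>Splitting \<open>2 l + 1\<close> yields the exponents \<open>\<alpha> - 1\<close> and \<open>\<alpha>\<close>, and hence the two summands of the
constant. The second tail even decays with one order more; this is given away, by \<open>\<kappa> \<ge> 1\<close>, to obtain a
single power of \<open>\<kappa>\<close>.\<close>

lemma angular_power_tail_le: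
  fixes A :: "nat \<Rightarrow> real" and \<alpha> C :: real
  assumes "\<alpha> > 2" "C > 0" "\<kappa> \<ge> 1"
    and A: "\<And>l. l > \<kappa> \<Longrightarrow> A l \<le> C * real l powr (- \<alpha>)"
  shows "(\<Sum>l<n. A (l + Suc \<kappa>) * (2 * real (l + Suc \<kappa>) + 1))
    \<le> C * (2 / (\<alpha> - 2) + 1 / (\<alpha> - 1)) * real \<kappa> powr (- (\<alpha> - 2))"
proof -
  have "(\<Sum>l<n. A (l + Suc \<kappa>) * (2 * real (l + Suc \<kappa>) + 1))
      \<le> (\<Sum>l<n. C * (2 * real (l + Suc \<kappa>) powr (- (\<alpha> - 1)) + real (l + Suc \<kappa>) powr (- \<alpha>)))"
  proof (rule sum_mono)
    fix l
    define x where "x = real (l + Suc \<kappa>)"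
    have "x > 0" by (simp add: x_def)
    have "A (l + Suc \<kappa>) * (2 * x + 1) \<le> C * x powr (- \<alpha>) * (2 * x + 1)"
      using A[of "l + Suc \<kappa>"] \<open>x > 0\<close> by (intro mult_right_mono) (auto simp: x_def)
    also have "\<dots> = C * (2 * (x powr (- \<alpha>) * x powr 1) + x powr (- \<alpha>))"
      using \<open>x > 0\<close> by (simp add: algebra_simps)
    also have "x powr (- \<alpha>) * x powr 1 = x powr (- (\<alpha> - 1))"
      by (simp only: powr_add[symmetric]) (simp add: algebra_simps)
    finally show "A (l + Suc \<kappa>) * (2 * real (l + Suc \<kappa>) + 1)
        \<le> C * (2 * real (l + Suc \<kappa>) powr (- (\<alpha> - 1)) + real (l + Suc \<kappa>) powr (- \<alpha>))"
      by (simp add: x_def)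
  qed
  also have "\<dots> = C * (2 * (\<Sum>l<n. real (l + Suc \<kappa>) powr (- (\<alpha> - 1))) + (\<Sum>l<n. real (l + Suc \<kappa>) powr (- \<alpha>)))"
    by (simp add: sum_distrib_left sum.distrib distrib_left)
  also have "\<dots> \<le> C * (2 * (real \<kappa> powr (1 - (\<alpha> - 1)) / (\<alpha> - 1 - 1)) + real \<kappa> powr (- (\<alpha> - 2)) / (\<alpha> - 1))"
  proof -
    have "(\<Sum>l<n. real (l + Suc \<kappa>) powr (- \<alpha>)) \<le> real \<kappa> powr (1 - \<alpha>) / (\<alpha> - 1)"
      using assms by (intro sum_powr_tail_le) auto
    also have "\<dots> \<le> real \<kappa> powr (- (\<alpha> - 2)) / (\<alpha> - 1)"
      using assms by (intro divide_right_mono powr_mono) auto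
    finally show ?thesis
      using assms sum_powr_tail_le[of "\<alpha> - 1" \<kappa> n] by (intro mult_left_mono add_mono) auto
  qed
  also have "\<dots> = C * (2 / (\<alpha> - 2) + 1 / (\<alpha> - 1)) * real \<kappa> powr (- (\<alpha> - 2))"
    by (simp add: algebra_simps)
  finally show ?thesis .
qed

section \<open>Second moments of the truncated expansion\<close>

definition KL_block :: "nat set \<Rightarrow> (nat \<times> nat \<times> nat) set" where
  "KL_block K = {(i, l, m) \<in> KL_index. l \<in> K}"

text \<open>The truncated expansion is a finite linear combination of the normal variables, indexed by
triples in \<open>KL_index\<close>, with these coefficients. For \<open>m = 0\<close> the cosine is 1.\<close>

definition KL_coeff :: "(nat \<Rightarrow> real) \<Rightarrow> real ^ 3 \<Rightarrow> nat \<times> nat \<times> nat \<Rightarrow> real" where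
  "KL_coeff A y = (\<lambda>(i, l, m). (if m = 0 then sqrt (A l) else sqrt (2 * A l)) * L_fun l m (colatitude y)
     * (if i = 1 then cos (real m * longitude y) else sin (real m * longitude y)))"

text \<open>The variance, at colatitude \<open>\<theta>\<close>, of the part of degree \<open>l\<close> of the expansion. The addition theorem
would identify it as the constant \<open>A l * (2 * l + 1) / (4 * \<pi>)\<close>; its integral over the sphere already follows from the
normalisation of the functions \<open>L_fun\<close>.\<close>

definition KL_degree_variance :: "(nat \<Rightarrow> real) \<Rightarrow> nat \<Rightarrow> real \<Rightarrow> real" where
  "KL_degree_variance A l \<theta> = A l * ((L_fun l 0 \<theta>)\<^sup>2 + 2 * (\<Sum>m=1..l. (L_fun l m \<theta>)\<^sup>2))"

lemma
  assumes "finite K"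
  shows finite_KL_block: "finite (KL_block K)"
    and sum_KL_block: "sum h (KL_block K) = (\<Sum>l\<in>K. h (1, l, 0) + (\<Sum>m=1..l. h (1, l, m) + h (2, l, m)))"
proof -
  let ?S = "SIGMA l:K. {0..l}" and ?T = "SIGMA l:K. {1..l}"
  have eq: "KL_block K = Pair 1 ` ?S \<union> Pair 2 ` ?T"
    by (auto simp: KL_block_def KL_index_def image_iff)
  have fin: "finite ?S" "finite ?T"
    using assms by auto
  then show "finite (KL_block K)"
    by (simp add: eq)
  have "sum h (KL_block K) = sum h (Pair 1 ` ?S) + sum h (Pair 2 ` ?T)"
    unfolding eq using fin by (intro sum.union_disjoint) auto
  also have "\<dots> = (\<Sum>(l, m)\<in>?S. h (1, l, m)) + (\<Sum>(l, m)\<in>?T. h (2, l, m))"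
    by (simp add: sum.reindex inj_on_def case_prod_beta')
  also have "\<dots> = (\<Sum>l\<in>K. \<Sum>m=0..l. h (1, l, m)) + (\<Sum>l\<in>K. \<Sum>m=1..l. h (2, l, m))"
    using assms by (simp add: sum.Sigma)
  also have "\<dots> = (\<Sum>l\<in>K. h (1, l, 0) + (\<Sum>m=1..l. h (1, l, m) + h (2, l, m)))"
    by (simp add: sum.atLeast_Suc_atMost sum.distrib add.assoc)
  finally show "sum h (KL_block K) = (\<Sum>l\<in>K. h (1, l, 0) + (\<Sum>m=1..l. h (1, l, m) + h (2, l, m)))" .
qed

lemma KL_trunc_eq_sum_KL_block:
  "KL_trunc A X \<kappa> \<omega> y = (\<Sum>j\<in>KL_block {0..\<kappa>}. KL_coeff A y j * (\<lambda>(i, l, m). X i l m) j \<omega>)"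
  by (simp add: sum_KL_block KL_trunc_def Let_def KL_coeff_def sum_distrib_left algebra_simps)

lemma KL_trunc_diff:
  assumes "\<kappa> \<le> n"
  shows "KL_trunc A X n \<omega> y - KL_trunc A X \<kappa> \<omega> y
    = (\<Sum>j\<in>KL_block {Suc \<kappa>..n}. KL_coeff A y j * (\<lambda>(i, l, m). X i l m) j \<omega>)"
proof -
  have "{0..n} = {0..\<kappa>} \<union> {Suc \<kappa>..n}"
    using assms by auto
  then have "KL_block {0..n} = KL_block {0..\<kappa>} \<union> KL_block {Suc \<kappa>..n}"
    by (auto simp: KL_block_def)
  moreover have "KL_block {0..\<kappa>} \<inter> KL_block {Suc \<kappa>..n} = {}"
    by (auto simp: KL_block_def)
  ultimately show ?thesis
    by (simp add: KL_trunc_eq_sum_KL_block sum.union_disjoint finite_KL_block)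
qed

text \<open>The longitude cancels, because for each \<open>m\<close> the sine and the cosine carry the same coefficient.\<close>

lemma sum_KL_coeff_sq:
  assumes "finite K" "\<And>l. A l \<ge> 0"
  shows "(\<Sum>j\<in>KL_block K. (KL_coeff A y j)\<^sup>2) = (\<Sum>l\<in>K. KL_degree_variance A l (colatitude y))"
proof -
  have "(KL_coeff A y (1, l, 0))\<^sup>2 + (\<Sum>m=1..l. (KL_coeff A y (1, l, m))\<^sup>2 + (KL_coeff A y (2, l, m))\<^sup>2)
      = KL_degree_variance A l (colatitude y)" for l
  proof -
    have "(KL_coeff A y (1, l, m))\<^sup>2 + (KL_coeff A y (2, l, m))\<^sup>2 = 2 * A l * (L_fun l m (colatitude y))\<^sup>2"
      if "m \<in> {1..l}" for m
    proof -
      have "(KL_coeff A y (1, l, m))\<^sup>2 + (KL_coeff A y (2, l, m))\<^sup>2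
        = 2 * A l * (L_fun l m (colatitude y))\<^sup>2 * ((cos (real m * longitude y))\<^sup>2 + (sin (real m * longitude y))\<^sup>2)"
        using that assms(2)[of l] unfolding distrib_left by (simp add: KL_coeff_def power_mult_distrib)
      then show ?thesis
        by simp
    qed
    then have "(\<Sum>m=1..l. (KL_coeff A y (1, l, m))\<^sup>2 + (KL_coeff A y (2, l, m))\<^sup>2)
        = (\<Sum>m=1..l. 2 * A l * (L_fun l m (colatitude y))\<^sup>2)"
      by (rule sum.cong[OF refl])
    moreover have "(KL_coeff A y (1, l, 0))\<^sup>2 = A l * (L_fun l 0 (colatitude y))\<^sup>2"
      using assms(2)[of l] by (simp add: KL_coeff_def power_mult_distrib)
    ultimately show ?thesis
      by (simp add: KL_degree_variance_def sum_distrib_left distrib_left mult_ac)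
  qed
  then show ?thesis
    using assms(1) by (simp add: sum_KL_block)
qed

lemma KL_degree_variance_nonneg:
  "A l \<ge> 0 \<Longrightarrow> KL_degree_variance A l \<theta> \<ge> 0"
  by (simp add: KL_degree_variance_def sum_nonneg)

lemma KL_degree_variance_measurable [measurable]: "KL_degree_variance A l \<in> borel_measurable borel"
  unfolding KL_degree_variance_def[abs_def] by measurable

lemma nn_integral_KL_degree_variance:
  assumes "A l \<ge> 0"
  shows "(\<integral>\<^sup>+y. ennreal (KL_degree_variance A l (colatitude y)) \<partial>S2_measure) = ennreal (A l * (2 * real l + 1))"
proof -
  have "((\<lambda>\<theta>. A l * ((L_fun l 0 \<theta>)\<^sup>2 * sin \<theta> + 2 * (\<Sum>m=1..l. (L_fun l m \<theta>)\<^sup>2 * sin \<theta>)))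
      has_integral A l * (1 / (2 * pi) + 2 * (\<Sum>m=1..l. 1 / (2 * pi)))) {0..pi}"
    by (intro has_integral_mult_right has_integral_add has_integral_sum has_integral_L_fun_sq) auto
  then have "((\<lambda>\<theta>. KL_degree_variance A l \<theta> * sin \<theta>) has_integral A l * (2 * real l + 1) / (2 * pi)) {0..pi}"
    by (simp add: KL_degree_variance_def sum_distrib_right distrib_right mult.assoc add_divide_distrib distrib_left add_ac)
  from nn_integral_S2_measure_zonal[OF _ _ this] show ?thesis
    using KL_degree_variance_nonneg[of A l] assms by simp
qed

lemma (in prob_space) nn_integral_square_KL_block:
  assumes X: "iid_standard_normal M X" and A: "\<And>l. A l \<ge> 0" and "finite K"
  shows "(\<integral>\<^sup>+\<omega>. ennreal ((\<Sum>j\<in>KL_block K. KL_coeff A y j * (\<lambda>(i, l, m). X i l m) j \<omega>)\<^sup>2) \<partial>M)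
    = (\<Sum>l\<in>K. ennreal (KL_degree_variance A l (colatitude y)))"
proof -
  have "KL_block K \<subseteq> KL_index"
    by (auto simp: KL_block_def)
  then have "(\<integral>\<^sup>+\<omega>. ennreal ((\<Sum>j\<in>KL_block K. KL_coeff A y j * (\<lambda>(i, l, m). X i l m) j \<omega>)\<^sup>2) \<partial>M)
      = ennreal (\<Sum>j\<in>KL_block K. (KL_coeff A y j)\<^sup>2)"
    by (intro nn_integral_square_orthonormal_sum finite_KL_block iid_standard_normal_orthonormal[OF X] \<open>finite K\<close>) auto
  also have "\<dots> = (\<Sum>l\<in>K. ennreal (KL_degree_variance A l (colatitude y)))"
    using A \<open>finite K\<close> by (simp add: sum_KL_coeff_sq sum_ennreal KL_degree_variance_nonneg)
  finally show ?thesis .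
qed

lemma (in prob_space) KL_trunc_measurable:
  assumes "iid_standard_normal M X"
  shows "case_prod (KL_trunc A X \<kappa>) \<in> borel_measurable (M \<Otimes>\<^sub>M restrict_space borel S2)"
proof -
  have "case_prod (KL_trunc A X \<kappa>)
      = (\<lambda>p. \<Sum>j\<in>KL_block {0..\<kappa>}. KL_coeff A (snd p) j * (\<lambda>(i, l, m). X i l m) j (fst p))"
    by (simp add: fun_eq_iff KL_trunc_eq_sum_KL_block)
  also have "\<dots> \<in> borel_measurable (M \<Otimes>\<^sub>M restrict_space borel S2)"
  proof (intro borel_measurable_sum borel_measurable_times)
    fix j assume "j \<in> KL_block {0..\<kappa>}"
    then have "j \<in> KL_index"
      by (auto simp: KL_block_def)
    then have "(\<lambda>(i, l, m). X i l m) j \<in> borel_measurable M"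
      using iid_standard_normal_orthonormal(1)[OF assms] by blast
    from measurable_compose[OF measurable_fst this]
    show "(\<lambda>p. (\<lambda>(i, l, m). X i l m) j (fst p)) \<in> borel_measurable (M \<Otimes>\<^sub>M restrict_space borel S2)" .
    show "(\<lambda>p. KL_coeff A (snd p) j) \<in> borel_measurable (M \<Otimes>\<^sub>M restrict_space borel S2)"
      unfolding KL_coeff_def case_prod_beta' by measurable
  qed
  finally show ?thesis .
qed

text \<open>The norm is an integral over \<open>\<Omega>\<close> outside and the sphere inside, whereas second moments are available
at fixed points of the sphere. Tonelli's theorem exchanges the order of integration, and finiteness of
the exchanged integral also gives membership in the space.\<close>

lemma (in prob_space) L2_field_norm_le:
  assumes meas: "case_prod F \<in> borel_measurable (M \<Otimes>\<^sub>M S2_measure)"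
    and bound: "(\<integral>\<^sup>+y. \<integral>\<^sup>+\<omega>. ennreal ((F \<omega> y)\<^sup>2) \<partial>M \<partial>S2_measure) \<le> ennreal B" and "B \<ge> 0"
  shows "F \<in> L2_fields M" "L2_field_norm M F \<le> sqrt B"
proof -
  interpret S2: finite_measure S2_measure
    by (rule finite_measure_S2_measure)
  interpret pair_sigma_finite M S2_measure ..
  have [measurable]: "(\<lambda>(\<omega>, y). (F \<omega> y)\<^sup>2) \<in> borel_measurable (M \<Otimes>\<^sub>M S2_measure)"
    using borel_measurable_power[OF meas, of 2] by (simp add: case_prod_beta')
  have "(\<integral>\<^sup>+p. ennreal ((\<lambda>(\<omega>, y). (F \<omega> y)\<^sup>2) p) \<partial>(M \<Otimes>\<^sub>M S2_measure))
      = (\<integral>\<^sup>+y. \<integral>\<^sup>+\<omega>. ennreal ((F \<omega> y)\<^sup>2) \<partial>M \<partial>S2_measure)"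
    by (subst nn_integral_snd[symmetric]) simp_all
  with bound have le: "(\<integral>\<^sup>+p. ennreal ((\<lambda>(\<omega>, y). (F \<omega> y)\<^sup>2) p) \<partial>(M \<Otimes>\<^sub>M S2_measure)) \<le> ennreal B"
    by simp
  then have int: "integrable (M \<Otimes>\<^sub>M S2_measure) (\<lambda>(\<omega>, y). (F \<omega> y)\<^sup>2)"
    by (intro integrableI_bounded) (auto simp: case_prod_beta' intro: le_less_trans)
  with meas show "F \<in> L2_fields M"
    by (simp add: L2_fields_def)
  have "(L2_S2_norm (F \<omega>))\<^sup>2 = (\<integral>y. (F \<omega> y)\<^sup>2 \<partial>S2_measure)" for \<omega>
    by (simp add: L2_S2_norm_def)
  then have "L2_field_norm M F = sqrt (integral\<^sup>L (M \<Otimes>\<^sub>M S2_measure) (\<lambda>(\<omega>, y). (F \<omega> y)\<^sup>2))"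
    unfolding L2_field_norm_def by (simp add: integral_fst[OF int])
  also have "\<dots> \<le> sqrt B"
  proof -
    have "ennreal (integral\<^sup>L (M \<Otimes>\<^sub>M S2_measure) (\<lambda>(\<omega>, y). (F \<omega> y)\<^sup>2)) \<le> ennreal B"
      using le by (subst (asm) nn_integral_eq_integral[OF int]) auto
    then show ?thesis
      using \<open>B \<ge> 0\<close> by (simp add: ennreal_le_iff)
  qed
  finally show "L2_field_norm M F \<le> sqrt B" .
qed

lemma L2_fields_add:
  assumes "F \<in> L2_fields M" "G \<in> L2_fields M"
  shows "(\<lambda>\<omega> y. F \<omega> y + G \<omega> y) \<in> L2_fields M"
proof -
  have m [measurable]: "case_prod F \<in> borel_measurable (M \<Otimes>\<^sub>M S2_measure)" "case_prod G \<in> borel_measurable (M \<Otimes>\<^sub>M S2_measure)"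
    and int: "integrable (M \<Otimes>\<^sub>M S2_measure) (\<lambda>p. 2 * (case_prod F p)\<^sup>2 + 2 * (case_prod G p)\<^sup>2)"
    using assms by (auto simp: L2_fields_def case_prod_beta')
  have meas: "(\<lambda>p. case_prod F p + case_prod G p) \<in> borel_measurable (M \<Otimes>\<^sub>M S2_measure)"
    by measurable
  have "integrable (M \<Otimes>\<^sub>M S2_measure) (\<lambda>p. (case_prod F p + case_prod G p)\<^sup>2)"
  proof (rule Bochner_Integration.integrable_bound[OF int])
    show "(\<lambda>p. (case_prod F p + case_prod G p)\<^sup>2) \<in> borel_measurable (M \<Otimes>\<^sub>M S2_measure)"
      by measurable
    have "(a + b)\<^sup>2 \<le> 2 * a\<^sup>2 + 2 * b\<^sup>2" for a b :: real
      using zero_le_power2[of "a - b"] by (simp add: power2_eq_square algebra_simps)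
    then show "AE p in M \<Otimes>\<^sub>M S2_measure. norm ((case_prod F p + case_prod G p)\<^sup>2)
        \<le> norm (2 * (case_prod F p)\<^sup>2 + 2 * (case_prod G p)\<^sup>2)"
      by simp
  qed
  with meas show ?thesis
    by (simp add: L2_fields_def case_prod_beta')
qed

lemma (in prob_space) KL_trunc_in_L2_fields:
  assumes X: "iid_standard_normal M X" and A: "\<And>l. A l \<ge> 0"
  shows "KL_trunc A X \<kappa> \<in> L2_fields M"
proof (rule L2_field_norm_le(1))
  show "case_prod (KL_trunc A X \<kappa>) \<in> borel_measurable (M \<Otimes>\<^sub>M S2_measure)"
    using KL_trunc_measurable[OF X] by (simp cong: measurable_cong_sets sets_pair_measure_cong)
  have "(\<integral>\<^sup>+\<omega>. ennreal ((KL_trunc A X \<kappa> \<omega> y)\<^sup>2) \<partial>M) = (\<Sum>l=0..\<kappa>. ennreal (KL_degree_variance A l (colatitude y)))" for y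
    unfolding KL_trunc_eq_sum_KL_block
    by (rule nn_integral_square_KL_block[OF X A]) simp
  then have "(\<integral>\<^sup>+y. \<integral>\<^sup>+\<omega>. ennreal ((KL_trunc A X \<kappa> \<omega> y)\<^sup>2) \<partial>M \<partial>S2_measure)
      = (\<Sum>l=0..\<kappa>. \<integral>\<^sup>+y. ennreal (KL_degree_variance A l (colatitude y)) \<partial>S2_measure)"
    by (simp add: nn_integral_sum)
  also have "\<dots> = ennreal (\<Sum>l=0..\<kappa>. A l * (2 * real l + 1))"
    using A by (simp add: nn_integral_KL_degree_variance sum_ennreal)
  finally show "(\<integral>\<^sup>+y. \<integral>\<^sup>+\<omega>. ennreal ((KL_trunc A X \<kappa> \<omega> y)\<^sup>2) \<partial>M \<partial>S2_measure)
      \<le> ennreal (\<Sum>l=0..\<kappa>. A l * (2 * real l + 1))"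
    by simp
  show "0 \<le> (\<Sum>l=0..\<kappa>. A l * (2 * real l + 1))"
    using A by (simp add: sum_nonneg)
qed

text \<open>The partial sums of the expansion beyond \<open>\<kappa>\<close> have the partial sums of the right-hand side as second moments, so the limit in probability
inherits the bound.\<close>

lemma (in prob_space) KL_truncation_error_at_point:
  assumes X: "iid_standard_normal M X" and A: "\<And>l. A l \<ge> 0"
    and KL: "KL_expansion M T A X" and "y \<in> S2"
    and T: "(\<lambda>\<omega>. T \<omega> y) \<in> borel_measurable M"
  shows "(\<integral>\<^sup>+\<omega>. ennreal ((T \<omega> y - KL_trunc A X \<kappa> \<omega> y)\<^sup>2) \<partial>M)
    \<le> (\<Sum>l. ennreal (KL_degree_variance A (l + Suc \<kappa>) (colatitude y)))"
proof (rule nn_integral_square_limit_in_probability[where Y = "\<lambda>n \<omega>. KL_trunc A X n \<omega> y" and k = \<kappa>])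
  show "(\<lambda>\<omega>. KL_trunc A X n \<omega> y) \<in> borel_measurable M" for n
    using measurable_compose[OF measurable_Pair2'[of y "restrict_space borel S2" M] KL_trunc_measurable[OF X]] \<open>y \<in> S2\<close>
    by (simp add: space_restrict_space)
  then show "(\<lambda>\<omega>. KL_trunc A X \<kappa> \<omega> y) \<in> borel_measurable M" .
  show "(\<lambda>n. prob {\<omega> \<in> space M. \<bar>T \<omega> y - KL_trunc A X n \<omega> y\<bar> > \<epsilon>}) \<longlonglongrightarrow> 0" if "\<epsilon> > 0" for \<epsilon>
    using KL \<open>y \<in> S2\<close> that by (auto simp: KL_expansion_def)
  show "(\<integral>\<^sup>+\<omega>. ennreal ((KL_trunc A X n \<omega> y - KL_trunc A X \<kappa> \<omega> y)\<^sup>2) \<partial>M)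
      \<le> (\<Sum>l. ennreal (KL_degree_variance A (l + Suc \<kappa>) (colatitude y)))" if "\<kappa> \<le> n" for n
  proof -
    have "(\<integral>\<^sup>+\<omega>. ennreal ((KL_trunc A X n \<omega> y - KL_trunc A X \<kappa> \<omega> y)\<^sup>2) \<partial>M)
        = (\<Sum>l\<in>{Suc \<kappa>..n}. ennreal (KL_degree_variance A l (colatitude y)))"
      unfolding KL_trunc_diff[OF that]
      by (rule nn_integral_square_KL_block[OF X A]) simp
    also have "\<dots> = (\<Sum>l<n - \<kappa>. ennreal (KL_degree_variance A (l + Suc \<kappa>) (colatitude y)))"
      using that by (intro sum.reindex_bij_witness[where i = "\<lambda>l. l + Suc \<kappa>" and j = "\<lambda>l. l - Suc \<kappa>"]) auto
    also have "\<dots> \<le> (\<Sum>l. ennreal (KL_degree_variance A (l + Suc \<kappa>) (colatitude y)))"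
      by (rule sum_le_suminf) auto
    finally show ?thesis .
  qed
qed (rule T)

lemma (in prob_space) KL_truncation_error:
  assumes X: "iid_standard_normal M X" and A: "\<And>l. A l \<ge> 0"
    and KL: "KL_expansion M T A X"
    and T: "case_prod T \<in> borel_measurable (M \<Otimes>\<^sub>M restrict_space borel S2)"
    and tail: "\<And>n. (\<Sum>l<n. A (l + Suc \<kappa>) * (2 * real (l + Suc \<kappa>) + 1)) \<le> B" and "B \<ge> 0"
  shows "(\<lambda>\<omega> y. T \<omega> y - KL_trunc A X \<kappa> \<omega> y) \<in> L2_fields M"
    and "L2_field_norm M (\<lambda>\<omega> y. T \<omega> y - KL_trunc A X \<kappa> \<omega> y) \<le> sqrt B"
proof -
  let ?F = "\<lambda>\<omega> y. T \<omega> y - KL_trunc A X \<kappa> \<omega> y"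
  have "(\<lambda>p. case_prod T p - case_prod (KL_trunc A X \<kappa>) p) \<in> borel_measurable (M \<Otimes>\<^sub>M restrict_space borel S2)"
    by (intro borel_measurable_diff T KL_trunc_measurable[OF X])
  then have meas: "case_prod ?F \<in> borel_measurable (M \<Otimes>\<^sub>M S2_measure)"
    by (simp add: case_prod_beta' cong: measurable_cong_sets sets_pair_measure_cong)
  have "(\<integral>\<^sup>+y. \<integral>\<^sup>+\<omega>. ennreal ((?F \<omega> y)\<^sup>2) \<partial>M \<partial>S2_measure)
      \<le> (\<integral>\<^sup>+y. (\<Sum>l. ennreal (KL_degree_variance A (l + Suc \<kappa>) (colatitude y))) \<partial>S2_measure)"
  proof (rule nn_integral_mono)
    fix y assume "y \<in> space S2_measure"
    then have "y \<in> S2"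
      by simp
    moreover from this have "(\<lambda>\<omega>. T \<omega> y) \<in> borel_measurable M"
      using measurable_compose[OF measurable_Pair2'[of y "restrict_space borel S2" M] T]
      by (simp add: space_restrict_space)
    ultimately show "(\<integral>\<^sup>+\<omega>. ennreal ((?F \<omega> y)\<^sup>2) \<partial>M)
        \<le> (\<Sum>l. ennreal (KL_degree_variance A (l + Suc \<kappa>) (colatitude y)))"
      by (rule KL_truncation_error_at_point[OF X A KL])
  qed
  also have "\<dots> = (\<Sum>l. \<integral>\<^sup>+y. ennreal (KL_degree_variance A (l + Suc \<kappa>) (colatitude y)) \<partial>S2_measure)"
    by (rule nn_integral_suminf) measurable
  also have "\<dots> = (\<Sum>l. ennreal (A (l + Suc \<kappa>) * (2 * real (l + Suc \<kappa>) + 1)))"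
    by (simp only: nn_integral_KL_degree_variance[of A, OF A])
  also have "\<dots> \<le> ennreal B"
  proof (rule suminf_le_const)
    show "(\<Sum>l<n. ennreal (A (l + Suc \<kappa>) * (2 * real (l + Suc \<kappa>) + 1))) \<le> ennreal B" for n
      using tail[of n] A by (subst sum_ennreal) (auto intro: ennreal_leI)
  qed simp
  finally have bound: "(\<integral>\<^sup>+y. \<integral>\<^sup>+\<omega>. ennreal ((?F \<omega> y)\<^sup>2) \<partial>M \<partial>S2_measure) \<le> ennreal B" .
  show "?F \<in> L2_fields M" "L2_field_norm M ?F \<le> sqrt B"
    using L2_field_norm_le[OF meas bound \<open>B \<ge> 0\<close>] by auto
qed

section \<open>Convergence of the truncated fields\<close>

theorem proposition5p2:
  fixes M :: "'w measure"
    and T :: "'w \<Rightarrow> real ^ 3 \<Rightarrow> real"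
    and A :: "nat \<Rightarrow> real"
    and X :: "nat \<Rightarrow> nat \<Rightarrow> nat \<Rightarrow> 'w \<Rightarrow> real"
    and \<alpha> C :: real
    and l0 :: nat
  assumes "prob_space M"
    and "centered_isotropic_gaussian_field M T"
    and "angular_power_spectrum M T A"
    and "iid_standard_normal M X"
    and "KL_expansion M T A X"
    and "\<alpha> > 2"
    and "C > 0"
    and "\<And>l. l > l0 \<Longrightarrow> A l \<le> C * real l powr (- \<alpha>)"
  shows "T \<in> L2_fields M \<and> (\<forall>\<kappa>. KL_trunc A X \<kappa> \<in> L2_fields M) \<and>
    (\<lambda>\<kappa>. L2_field_norm M (\<lambda>\<omega> y. T \<omega> y - KL_trunc A X \<kappa> \<omega> y)) \<longlonglongrightarrow> 0 \<and>
    (\<forall>\<kappa>\<ge>1. \<kappa> \<ge> l0 \<longrightarrow>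
      L2_field_norm M (\<lambda>\<omega> y. T \<omega> y - KL_trunc A X \<kappa> \<omega> y)
        \<le> sqrt (C * (2 / (\<alpha> - 2) + 1 / (\<alpha> - 1))) * real \<kappa> powr (- (\<alpha> - 2) / 2))"
proof -
  interpret prob_space M
    by fact
  define D where "D = C * (2 / (\<alpha> - 2) + 1 / (\<alpha> - 1))"
  have "D \<ge> 0"
    using assms by (simp add: D_def)
  have A: "A l \<ge> 0" for l
    using assms by (simp add: angular_power_spectrum_def)
  have T: "case_prod T \<in> borel_measurable (M \<Otimes>\<^sub>M restrict_space borel S2)"
    using assms by (simp add: centered_isotropic_gaussian_field_def gaussian_random_field_def)
  let ?F = "\<lambda>\<kappa> \<omega> y. T \<omega> y - KL_trunc A X \<kappa> \<omega> y"
  have error: "?F \<kappa> \<in> L2_fields M" "L2_field_norm M (?F \<kappa>) \<le> sqrt D * real \<kappa> powr (- (\<alpha> - 2) / 2)"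
    if "\<kappa> \<ge> 1" "\<kappa> \<ge> l0" for \<kappa>
  proof -
    define B where "B = D * real \<kappa> powr (- (\<alpha> - 2))"
    have tail: "(\<Sum>l<n. A (l + Suc \<kappa>) * (2 * real (l + Suc \<kappa>) + 1)) \<le> B" for n
      unfolding B_def D_def using assms(6-8) that by (intro angular_power_tail_le) auto
    have "B \<ge> 0"
      using \<open>D \<ge> 0\<close> by (simp add: B_def)
    note KL_truncation_error[OF assms(4) A assms(5) T tail this]
    moreover have "sqrt B = sqrt D * real \<kappa> powr (- (\<alpha> - 2) / 2)"
      by (simp add: B_def real_sqrt_mult powr_half_sqrt[symmetric] powr_powr)
    ultimately show "?F \<kappa> \<in> L2_fields M" "L2_field_norm M (?F \<kappa>) \<le> sqrt D * real \<kappa> powr (- (\<alpha> - 2) / 2)"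
      by simp_all
  qed
  have trunc: "KL_trunc A X \<kappa> \<in> L2_fields M" for \<kappa>
    by (rule KL_trunc_in_L2_fields) (use assms A in auto)
  (* Any admissible truncation level shows that the field is the sum of two square-integrable ones. *)
  have "T \<in> L2_fields M"
    using L2_fields_add[OF error(1)[of "max 1 l0"] trunc[of "max 1 l0"]] by simp
  moreover have "(\<lambda>\<kappa>. L2_field_norm M (?F \<kappa>)) \<longlonglongrightarrow> 0"
  proof (rule tendsto_sandwich)
    show "\<forall>\<^sub>F \<kappa> in sequentially. 0 \<le> L2_field_norm M (?F \<kappa>)"
      by (simp add: L2_field_norm_def)
    show "\<forall>\<^sub>F \<kappa> in sequentially. L2_field_norm M (?F \<kappa>) \<le> sqrt D * real \<kappa> powr (- (\<alpha> - 2) / 2)"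
      using eventually_ge_at_top[of "max 1 l0"] by eventually_elim (rule error(2), simp_all)
    have "(\<lambda>\<kappa>. real \<kappa> powr (- (\<alpha> - 2) / 2)) \<longlonglongrightarrow> 0"
      using assms(6) by (intro tendsto_neg_powr filterlim_real_sequentially) auto
    then show "(\<lambda>\<kappa>. sqrt D * real \<kappa> powr (- (\<alpha> - 2) / 2)) \<longlonglongrightarrow> 0"
      by (rule tendsto_mult_right_zero)
  qed simp
  ultimately show ?thesis
    using trunc error(2) unfolding D_def by blast
qed

end
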